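(* Let $m\geq 1$ be an integer and let $f$ be a non-negative integer with $f<4m-2$. If there exists a Hadamard $(4m-1,2m-1,m-1)$-design that is $f$-pyramidal under the action of some group $G$ of automorphisms, then $f\leq 2m-1$.
   Context: A $(v,k,\lambda)$-design is a pair $\mathcal{D}=(P,\mathcal{B})$ where $P$ is a set of $v$ points and $\mathcal{B}$ is a collection of $k$-subsets of $P$, called blocks, such that every pair of distinct points of $P$ occurs in exactly $\lambda$ blocks. It is symmetric if $|\mathcal{B}|=v$. A Hadamard design is a symmetric design with parameters $(v,k,\lambda)=(4m-1,2m-1,m-1)$. An automorphism of $\mathcal{D}$ is a permutation of $P$ mapping $\mathcal{B}$ onto itself. Given a group $G$ of automorphisms of $\mathcal{D}$, the design $\mathcal{D}$ is called $f$-pyramidal under the action of $G$ if $G$ fixes exactly $f$ points and acts sharply transitively (regularly) on the remaining $v-f$ points. *)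

theory Defs
  imports "HOL-Algebra.Bij"
begin

definition design :: "'a set \<Rightarrow> 'a set set \<Rightarrow> nat \<Rightarrow> nat \<Rightarrow> nat \<Rightarrow> bool" where
  "design P \<B> v k l \<longleftrightarrow>
     finite P \<and> card P = v \<and>
     (\<forall>B\<in>\<B>. B \<subseteq> P \<and> card B = k) \<and>
     (\<forall>x\<in>P. \<forall>y\<in>P. x \<noteq> y \<longrightarrow> card {B\<in>\<B>. x \<in> B \<and> y \<in> B} = l)"

definition symmetric_design :: "'a set \<Rightarrow> 'a set set \<Rightarrow> nat \<Rightarrow> nat \<Rightarrow> nat \<Rightarrow> bool" where
  "symmetric_design P \<B> v k l \<longleftrightarrow> design P \<B> v k l \<and> card \<B> = v"

text \<open>The subtractions on natural numbers do not truncate when \<open>m \<ge> 1\<close>.\<close>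

definition hadamard_design :: "'a set \<Rightarrow> 'a set set \<Rightarrow> nat \<Rightarrow> bool" where
  "hadamard_design P \<B> m \<longleftrightarrow> symmetric_design P \<B> (4 * m - 1) (2 * m - 1) (m - 1)"

text \<open>As in \<^const>\<open>BijGroup\<close>, a permutation of \<open>P\<close> is represented by the function that is
  \<^const>\<open>undefined\<close> outside \<open>P\<close>, so that distinct group elements differ on \<open>P\<close>.\<close>

definition design_automorphisms :: "'a set \<Rightarrow> 'a set set \<Rightarrow> ('a \<Rightarrow> 'a) set" where
  "design_automorphisms P \<B> = {g \<in> Bij P. (`) g ` \<B> = \<B>}"

definition automorphism_group_of :: "('a \<Rightarrow> 'a) set \<Rightarrow> 'a set \<Rightarrow> 'a set set \<Rightarrow> bool" where
  "automorphism_group_of G P \<B> \<longleftrightarrow> subgroup G (BijGroup P) \<and> G \<subseteq> design_automorphisms P \<B>"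

definition fixed_points :: "('a \<Rightarrow> 'a) set \<Rightarrow> 'a set \<Rightarrow> 'a set" where
  "fixed_points G P = {x \<in> P. \<forall>g\<in>G. g x = x}"

definition sharply_transitive_on :: "('a \<Rightarrow> 'a) set \<Rightarrow> 'a set \<Rightarrow> bool" where
  "sharply_transitive_on G X \<longleftrightarrow> (\<forall>x\<in>X. \<forall>y\<in>X. \<exists>!g. g \<in> G \<and> g x = y)"

definition pyramidal :: "nat \<Rightarrow> ('a \<Rightarrow> 'a) set \<Rightarrow> 'a set \<Rightarrow> 'a set set \<Rightarrow> bool" where
  "pyramidal f G P \<B> \<longleftrightarrow>
     automorphism_group_of G P \<B> \<and>
     card (fixed_points G P) = f \<and>
     sharply_transitive_on G (P - fixed_points G P)"

end

theory Submission
  imports Defs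
begin

text \<open>
  As \<open>f\<close> is smaller than the number of points, the group contains a nontrivial automorphism, and
  this automorphism fixes every point that the group fixes. For \<open>m \<ge> 2\<close>, the bound is therefore an instance of the classical fact, due to Feit, that
  a nontrivial automorphism \<open>g\<close> of a symmetric \<open>(v, k, \<lambda>)\<close>-design fixes at most
  \<open>v - 2 (k - \<lambda>)\<close> points; for a Hadamard design this number is \<open>2 m - 1\<close>.

  To see Feit's bound, choose a block \<open>C\<close> with \<open>g ` C \<noteq> C\<close>. A fixed point lies in \<open>C\<close> if and only if it
  lies in \<open>g ` C\<close>, so all fixed points avoid the symmetric difference of these two blocks. Two blocks
  of a symmetric design meet in exactly \<open>\<lambda>\<close> points, so this difference has \<open>2 (k - \<lambda>)\<close> elements.

  The intersection property (\<open>symmetric_design_blocks_meet\<close>) is usually obtained from the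
  invertibility of the incidence matrix. Here it comes from a variance argument: relative to a fixed block, the first two
  moments of the intersection sizes are determined by double counting, and they show that the
  squared deviations from \<open>\<lambda>\<close> add up to zero.
\<close>

lemma design_finite_blocks: "design P \<B> v k l \<Longrightarrow> finite \<B>"
  unfolding design_def by (meson PowI finite_Pow_iff finite_subset subsetI)

text \<open>
  The summand \<open>y = x\<close> counts all blocks through \<open>x\<close>, and each of the others is \<open>l\<close>. The case \<open>Y = P\<close>
  gives the number of blocks through a point, and the case where \<open>Y\<close> is a block gives the second
  moment of the intersection sizes.
\<close>

lemma design_sum_pair_counts:
  assumes "design P \<B> v k l" "Y \<subseteq> P" "x \<in> Y"
  shows "(\<Sum>y\<in>Y. card {C\<in>\<B>. x \<in> C \<and> y \<in> C}) = card {C\<in>\<B>. x \<in> C} + (card Y - 1) * l"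
proof -
  have fin: "finite Y"
    using assms unfolding design_def by (meson finite_subset)
  have "(\<Sum>y\<in>Y - {x}. card {C\<in>\<B>. x \<in> C \<and> y \<in> C}) = (\<Sum>y\<in>Y - {x}. l)"
    using assms unfolding design_def by (intro sum.cong refl) (metis DiffD1 DiffD2 singletonI subsetD)
  then show ?thesis
    using fin assms(3) by (simp add: sum.remove[of Y x])
qed

lemma design_replication:
  assumes des: "design P \<B> v k l" and x: "x \<in> P"
  shows "card {C\<in>\<B>. x \<in> C} * k = card {C\<in>\<B>. x \<in> C} + (v - 1) * l"
proof -
  have P: "finite P" "card P = v" and blk: "\<And>C. C \<in> \<B> \<Longrightarrow> C \<subseteq> P \<and> card C = k"
    using des unfolding design_def by auto
  let ?S = "{C\<in>\<B>. x \<in> C}"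
  have "card ?S * k = (\<Sum>C\<in>?S. card {y\<in>P. y \<in> C})"
    using blk by (simp add: Int_absorb1 flip: Int_def)
  also have "\<dots> = (\<Sum>y\<in>P. card {C\<in>\<B>. x \<in> C \<and> y \<in> C})"
    using design_finite_blocks[OF des] P by (intro sum_multicount_gen) (auto simp: conj_assoc)
  finally show ?thesis
    using design_sum_pair_counts[OF des subset_refl x] P by simp
qed

text \<open>
  Counting flags gives average replication number \<open>k\<close>, since there are as many blocks as points.
  For \<open>k > 1\<close> the identity \<open>r (k - 1) = (v - 1) l\<close> makes the replication number constant, so it
  equals its average.
\<close>

lemma symmetric_design_replication:
  assumes sym: "symmetric_design P \<B> v k l" and k: "1 < k" and x: "x \<in> P"
  shows "card {C\<in>\<B>. x \<in> C} = k"
proof -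
  have des: "design P \<B> v k l" and b: "card \<B> = v"
    using sym unfolding symmetric_design_def by auto
  have P: "finite P" "card P = v" and blk: "\<And>C. C \<in> \<B> \<Longrightarrow> C \<subseteq> P \<and> card C = k"
    using des unfolding design_def by auto
  let ?r = "\<lambda>y. card {C\<in>\<B>. y \<in> C}"
  have const: "?r y = ?r x" if "y \<in> P" for y
  proof -
    have "?r z * (k - 1) = (v - 1) * l" if "z \<in> P" for z
      using design_replication[OF des that] by (simp add: diff_mult_distrib2)
    from this[OF that] this[OF x] have "?r y * (k - 1) = ?r x * (k - 1)"
      by simp
    then show ?thesis
      using k by simp
  qed
  have "v * k = (\<Sum>C\<in>\<B>. card {y\<in>P. y \<in> C})"
    using blk b by (simp add: Int_absorb1 flip: Int_def)
  also have "\<dots> = (\<Sum>y\<in>P. ?r y)"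
    using design_finite_blocks[OF des] P by (intro sum_multicount_gen) auto
  also have "\<dots> = v * ?r x"
    using const P by simp
  finally have "v * k = v * ?r x" .
  moreover have "v > 0"
    using P x card_gt_0_iff by blast
  ultimately show ?thesis
    by simp
qed

text \<open>
  For a fixed block \<open>B\<close>, counting pairs \<open>(C, x)\<close> and triples \<open>(C, x, y)\<close> with \<open>x, y \<in> B \<inter> C\<close>
  gives the sums of \<open>card (B \<inter> C)\<close> and of its square over all blocks \<open>C\<close>. After removing the term
  \<open>C = B\<close>, the identity \<open>k (k - 1) = (v - 1) l\<close> makes the squared deviations from \<open>l\<close> sum to zero.
\<close>

lemma symmetric_design_blocks_meet:
  assumes sym: "symmetric_design P \<B> v k l" and k: "1 < k"
    and B: "B \<in> \<B>" and D: "D \<in> \<B>" "D \<noteq> B"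
  shows "card (B \<inter> D) = l"
proof -
  have des: "design P \<B> v k l" and b: "card \<B> = v"
    using sym unfolding symmetric_design_def by auto
  have finB: "finite \<B>"
    using des by (rule design_finite_blocks)
  have BP: "B \<subseteq> P" and cardB: "card B = k"
    using des B unfolding design_def by auto
  have fB: "finite B"
    using cardB k by (intro card_ge_0_finite) simp
  have r: "card {C\<in>\<B>. x \<in> C} = k" if "x \<in> B" for x
    using symmetric_design_replication[OF sym k] that BP by auto
  have v: "v > 0"
    using B b finB card_gt_0_iff by blast
  have kk: "int k * int k = int k + (int v - 1) * int l"
  proof -
    obtain x where "x \<in> B"
      using cardB k by fastforce
    then have "k * k = k + (v - 1) * l"
      using design_replication[OF des, of x] r BP by auto
    then have "int (k * k) = int (k + (v - 1) * l)"
      by (rule arg_cong)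
    then show ?thesis
      using v by (simp add: of_nat_diff)
  qed
  let ?a = "\<lambda>C. int (card (B \<inter> C))"
  have "(\<Sum>C\<in>\<B>. card {x\<in>B. x \<in> C}) = (\<Sum>x\<in>B. card {C\<in>\<B>. x \<in> C})"
    using finB fB by (intro sum_multicount_gen) auto
  also have "\<dots> = k * k"
    using r cardB by simp
  finally have "(\<Sum>C\<in>\<B>. card (B \<inter> C)) = k * k"
    by (simp flip: Int_def)
  then have first: "(\<Sum>C\<in>\<B>. ?a C) = int k * int k"
    by (metis of_nat_mult of_nat_sum)
  have "(\<Sum>C\<in>\<B>. card {p\<in>B \<times> B. fst p \<in> C \<and> snd p \<in> C})
      = (\<Sum>p\<in>B \<times> B. card {C\<in>\<B>. fst p \<in> C \<and> snd p \<in> C})"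
    using finB fB by (intro sum_multicount_gen) auto
  also have "\<dots> = (\<Sum>x\<in>B. \<Sum>y\<in>B. card {C\<in>\<B>. x \<in> C \<and> y \<in> C})"
    by (simp add: sum.cartesian_product case_prod_unfold)
  also have "\<dots> = (\<Sum>x\<in>B. k + (k - 1) * l)"
    using design_sum_pair_counts[OF des BP] r cardB by (intro sum.cong) auto
  also have "\<dots> = k * (k + (k - 1) * l)"
    using cardB by simp
  finally have "(\<Sum>C\<in>\<B>. card {p\<in>B \<times> B. fst p \<in> C \<and> snd p \<in> C}) = k * (k + (k - 1) * l)" .
  moreover have "{p\<in>B \<times> B. fst p \<in> C \<and> snd p \<in> C} = (B \<inter> C) \<times> (B \<inter> C)" for C
    by auto
  ultimately have "(\<Sum>C\<in>\<B>. card (B \<inter> C) * card (B \<inter> C)) = k * (k + (k - 1) * l)"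
    by (simp add: card_cartesian_product)
  then have "int (\<Sum>C\<in>\<B>. card (B \<inter> C) * card (B \<inter> C)) = int (k * (k + (k - 1) * l))"
    by (rule arg_cong)
  then have second: "(\<Sum>C\<in>\<B>. ?a C * ?a C) = int k * (int k + (int k - 1) * int l)"
    using k by (simp add: of_nat_diff)
  have first': "(\<Sum>C\<in>\<B> - {B}. ?a C) = int k * int k - int k"
    using first finB B cardB by (simp add: sum_diff1)
  have second': "(\<Sum>C\<in>\<B> - {B}. ?a C * ?a C) = int k * (int k - 1) * int l"
    using second finB B cardB by (simp add: sum_diff1 algebra_simps)
  have "(\<Sum>C\<in>\<B> - {B}. (?a C - int l)\<^sup>2)
      = (\<Sum>C\<in>\<B> - {B}. ?a C * ?a C) - 2 * int l * (\<Sum>C\<in>\<B> - {B}. ?a C)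
        + (\<Sum>C\<in>\<B> - {B}. int l * int l)"
    by (simp add: power2_eq_square algebra_simps sum.distrib sum_subtractf sum_distrib_left)
  also have "(\<Sum>C\<in>\<B> - {B}. int l * int l) = (int v - 1) * (int l * int l)"
    using finB B b v by (simp add: of_nat_diff)
  also note first'
  also note second'
  also have "int k * (int k - 1) * int l - 2 * int l * (int k * int k - int k)
      + (int v - 1) * (int l * int l) = 0"
    using kk by algebra
  finally have "(\<Sum>C\<in>\<B> - {B}. (?a C - int l)\<^sup>2) = 0" .
  then have "(?a D - int l)\<^sup>2 = 0"
    using finB D by (subst (asm) sum_nonneg_eq_0_iff) auto
  then show ?thesis
    by simp
qed

text \<open>
  A nontrivial automorphism moves some block: otherwise all \<open>k\<close> blocks through a moved point \<open>x\<close>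
  would contain \<open>g x\<close>, while only \<open>l < k\<close> blocks contain both points.
\<close>

lemma symmetric_design_moved_block:
  assumes sym: "symmetric_design P \<B> v k l" and k: "1 < k" and lk: "l < k"
    and g: "g \<in> design_automorphisms P \<B>" and x: "x \<in> P" "g x \<noteq> x"
  obtains C where "C \<in> \<B>" "g ` C \<noteq> C"
proof -
  have "g x \<in> P"
    using g x unfolding design_automorphisms_def Bij_def bij_betw_def by auto
  then have l: "card {C\<in>\<B>. x \<in> C \<and> g x \<in> C} = l"
    using sym x unfolding symmetric_design_def design_def by auto
  have "\<exists>C\<in>\<B>. g ` C \<noteq> C"
  proof (rule ccontr)
    assume "\<not> ?thesis"
    then have "{C\<in>\<B>. x \<in> C} = {C\<in>\<B>. x \<in> C \<and> g x \<in> C}"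
      by (auto; blast)
    then show False
      using symmetric_design_replication[OF sym k x(1)] l lk by simp
  qed
  with that show thesis
    by blast
qed

text \<open>
  Feit's bound. The fixed points of \<open>g\<close> and the two halves of the symmetric difference of a moved
  block and its image are pairwise disjoint.
\<close>

lemma symmetric_design_card_fixed_points_le:
  assumes sym: "symmetric_design P \<B> v k l" and k: "1 < k" and lk: "l < k"
    and g: "g \<in> design_automorphisms P \<B>" and x: "x \<in> P" "g x \<noteq> x"
  shows "card {y\<in>P. g y = y} + 2 * (k - l) \<le> v"
proof -
  have P: "finite P" "card P = v" and blk: "\<And>C. C \<in> \<B> \<Longrightarrow> C \<subseteq> P \<and> card C = k"
    using sym unfolding symmetric_design_def design_def by auto
  have inj: "inj_on g P" and im: "(`) g ` \<B> = \<B>"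
    using g unfolding design_automorphisms_def Bij_def bij_betw_def by auto
  obtain C where C: "C \<in> \<B>" "g ` C \<noteq> C"
    using symmetric_design_moved_block[OF assms] .
  let ?D = "g ` C" and ?F = "{y\<in>P. g y = y}"
  have D: "?D \<in> \<B>"
    using C im by blast
  have sub: "C \<subseteq> P" "?D \<subseteq> P"
    using blk C D by blast+
  then have fin: "finite C" "finite ?D"
    using P finite_subset by blast+
  have meet: "card (C \<inter> ?D) = l"
    using symmetric_design_blocks_meet[OF sym k C(1) D C(2)] .
  have halves: "card (C - ?D) = k - l" "card (?D - C) = k - l"
    using meet blk[OF C(1)] blk[OF D] fin card_Diff_subset_Int[of C ?D] card_Diff_subset_Int[of ?D C]
    by (simp_all add: Int_commute)
  have avoid: "y \<in> C \<longleftrightarrow> y \<in> ?D" if "y \<in> ?F" for y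
  proof
    show "y \<in> ?D" if "y \<in> C"
      using that \<open>y \<in> ?F\<close> by force
    show "y \<in> C" if yD: "y \<in> ?D"
    proof -
      obtain z where "z \<in> C" "y = g z"
        using yD by blast
      then show ?thesis
        using \<open>y \<in> ?F\<close> sub inj by (metis (mono_tags, lifting) inj_onD mem_Collect_eq subsetD)
    qed
  qed
  have "card ?F + (card (C - ?D) + card (?D - C)) = card (?F \<union> ((C - ?D) \<union> (?D - C)))"
    using P fin avoid by (subst card_Un_disjoint; auto)+
  also have "\<dots> \<le> card P"
    using P sub by (intro card_mono) auto
  finally show ?thesis
    using halves P by simp
qed

theorem corollary3p1:
  fixes m f :: nat
  assumes "m \<ge> 1"
    and "f < 4 * m - 2"
    and "\<exists>(P :: 'a set) \<B> G. hadamard_design P \<B> m \<and> pyramidal f G P \<B>"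
  shows "f \<le> 2 * m - 1"
proof (cases "m = 1")
  \<comment> \<open>Here \<open>k = 1\<close>, so that counting pairs inside a block says nothing, but the hypothesis reads \<open>f < 2\<close>.\<close>
  case True
  then show ?thesis
    using assms(2) by simp
next
  case False
  with assms(1) have m: "m \<ge> 2"
    by simp
  obtain P :: "'a set" and \<B> G where had: "hadamard_design P \<B> m" and pyr: "pyramidal f G P \<B>"
    using assms(3) by blast
  have sym: "symmetric_design P \<B> (4 * m - 1) (2 * m - 1) (m - 1)"
    using had unfolding hadamard_design_def .
  then have P: "finite P" "card P = 4 * m - 1"
    unfolding symmetric_design_def design_def by auto
  have aut: "G \<subseteq> design_automorphisms P \<B>" and f: "card (fixed_points G P) = f"
    using pyr unfolding pyramidal_def automorphism_group_of_def by auto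
  have "fixed_points G P \<noteq> P"
    using P f assms(2) by auto
  then obtain x g where x: "x \<in> P" and g: "g \<in> G" "g x \<noteq> x"
    unfolding fixed_points_def by blast
  have "f \<le> card {y\<in>P. g y = y}"
    unfolding f[symmetric] using P g by (intro card_mono) (auto simp: fixed_points_def)
  moreover have "card {y\<in>P. g y = y} + 2 * ((2 * m - 1) - (m - 1)) \<le> 4 * m - 1"
    using symmetric_design_card_fixed_points_le[of P \<B> _ _ _ g x, OF sym] x aut g m by auto
  ultimately show ?thesis
    using m by simp
qed

end
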